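(* Let $n\ge 1$, let $N$ be an $n$-dimensional $C^\infty$ manifold without boundary, let $(g,\nu): N\to\mathbb{R}^{n+1}\times S^n$ be a frontal, and let $P\in\mathbb{R}^{n+1}$ be a point of $\mathcal{NS}_g$, i.e. $(g(x)-P)\cdot\nu(x)\neq 0$ for every $x\in N$. Define $$\widetilde f(x)=2g(x)-P-\frac{\|g(x)-P\|^2}{(g(x)-P)\cdot\nu(x)}\,\nu(x),\qquad \widetilde\nu(x)=\frac{g(x)-P}{\|g(x)-P\|},\qquad \gamma(x)=\|g(x)-P\|.$$ Suppose that $\widetilde\nu: N\to S^n$ is non-singular at $x\in N$. Then $$\widetilde f(x)-g(x)=\left(\left(J\widetilde\nu(x)\right)^{-1}\right)^t\nabla\gamma(x)\ \oplus\ 0\,\widetilde\nu(x).$$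
   Context: All mappings are of class $C^\infty$; $S^n\subset\mathbb{R}^{n+1}$ is the unit sphere and $\cdot$ the Euclidean scalar product. A mapping $g:N\to\mathbb{R}^{n+1}$ is a frontal if there is a mapping $\nu:N\to S^n$ (its Gauss mapping) with $dg_x(\mathbf v)\cdot\nu(x)=0$ for all $x\in N$, $\mathbf v\in T_xN$; the pair $(g,\nu)$ is also called a frontal. The mapping $(\widetilde f,\widetilde\nu)$ is a frontal, the negative pedal of $g$ relative to $P$. "Non-singular at $x$" means that $d\widetilde\nu_x: T_xN\to T_{\widetilde\nu(x)}S^n$ has rank $n$. The identification $\mathbb{R}^{n+1}=T_{\widetilde\nu(x)}\mathbb{R}^{n+1}=T_{\widetilde\nu(x)}S^n\oplus\mathbb{R}\widetilde\nu(x)$ is used: $a\oplus b\,\widetilde\nu(x)$ denotes the vector with component $a$ in $T_{\widetilde\nu(x)}S^n$ and component $b\,\widetilde\nu(x)$ in $\mathbb{R}\widetilde\nu(x)$. $J\widetilde\nu(x)$ is the $n\times n$ Jacobian matrix of $\widetilde\nu$ at $x$ with respect to an arbitrary local coordinate system of $N$ around $x$ and the normal coordinate system of $S^n$ around $\widetilde\nu(x)$ (for the standard round metric, so that coordinate vectors at $\widetilde\nu(x)$ are identified with elements of $T_{\widetilde\nu(x)}S^n$ via an orthonormal basis); $\nabla\gamma(x)$ is the column vector of first partial derivatives of $\gamma$ at $x$ in the same local coordinate system of $N$; $(\cdot)^t$ denotes transpose. *)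

theory Defs
  imports "HOL-Analysis.Analysis"
begin

text \<open>The predicate below is only meant for open \<open>S\<close>: it uses derivatives at the points of \<open>S\<close>
  in the ambient space.\<close>

fun k_smooth_on ::
  "nat \<Rightarrow> 'a::euclidean_space set \<Rightarrow> ('a \<Rightarrow> 'b::euclidean_space) \<Rightarrow> bool" where
  "k_smooth_on 0 S f \<longleftrightarrow> continuous_on S f"
| "k_smooth_on (Suc k) S f \<longleftrightarrow>
     (\<forall>x\<in>S. f differentiable (at x)) \<and>
     (\<forall>v. k_smooth_on k S (\<lambda>x. frechet_derivative f (at x) v))"

definition smooth_on :: "'a::euclidean_space set \<Rightarrow> ('a \<Rightarrow> 'b::euclidean_space) \<Rightarrow> bool" where
  "smooth_on S f \<longleftrightarrow> (\<forall>k. k_smooth_on k S f)"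

definition chart_on :: "'a topology \<Rightarrow> 'a set \<Rightarrow> ('a \<Rightarrow> real^'n) \<Rightarrow> bool" where
  "chart_on N U \<phi> \<longleftrightarrow>
     openin N U \<and> open (\<phi> ` U) \<and>
     homeomorphic_map (subtopology N U) (top_of_set (\<phi> ` U)) \<phi>"

definition compatible_charts ::
  "'a set \<Rightarrow> ('a \<Rightarrow> real^'n) \<Rightarrow> 'a set \<Rightarrow> ('a \<Rightarrow> real^'n) \<Rightarrow> bool" where
  "compatible_charts U \<phi> V \<psi> \<longleftrightarrow>
     smooth_on (\<phi> ` (U \<inter> V)) (\<psi> \<circ> inv_into U \<phi>) \<and>
     smooth_on (\<psi> ` (U \<inter> V)) (\<phi> \<circ> inv_into V \<psi>)"

text \<open>\<open>A\<close> is the maximal atlas, so its elements are exactly the local coordinate systems of the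
  manifold. The dimension of the manifold is \<open>CARD('n)\<close>.\<close>

definition smooth_manifold :: "'a topology \<Rightarrow> ('a set \<times> ('a \<Rightarrow> real^'n)) set \<Rightarrow> bool" where
  "smooth_manifold N A \<longleftrightarrow>
     Hausdorff_space N \<and> second_countable N \<and>
     (\<forall>(U, \<phi>) \<in> A. chart_on N U \<phi>) \<and>
     (\<Union>(U, \<phi>) \<in> A. U) = topspace N \<and>
     (\<forall>(U, \<phi>) \<in> A. \<forall>(V, \<psi>) \<in> A. compatible_charts U \<phi> V \<psi>) \<and>
     (\<forall>U \<phi>. chart_on N U \<phi> \<and> (\<forall>(V, \<psi>) \<in> A. compatible_charts U \<phi> V \<psi>) \<longrightarrow> (U, \<phi>) \<in> A)"

definition smooth_map ::
  "('a set \<times> ('a \<Rightarrow> real^'n)) set \<Rightarrow> ('a \<Rightarrow> 'b::euclidean_space) \<Rightarrow> bool" where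
  "smooth_map A f \<longleftrightarrow> (\<forall>(U, \<phi>) \<in> A. smooth_on (\<phi> ` U) (f \<circ> inv_into U \<phi>))"

text \<open>The differential of \<open>f\<close> at \<open>x\<close>, where the tangent space at \<open>x\<close> is identified with
  \<open>real^'n\<close> by means of the coordinate vectors of the chart \<open>(U, \<phi>)\<close>.\<close>

definition chart_differential ::
  "'a set \<Rightarrow> ('a \<Rightarrow> real^'n) \<Rightarrow> ('a \<Rightarrow> 'b::euclidean_space) \<Rightarrow> 'a \<Rightarrow> real^'n \<Rightarrow> 'b" where
  "chart_differential U \<phi> f x = frechet_derivative (f \<circ> inv_into U \<phi>) (at (\<phi> x))"

definition chart_jacobian ::
  "'a set \<Rightarrow> ('a \<Rightarrow> real^'n) \<Rightarrow> ('a \<Rightarrow> real^'k) \<Rightarrow> 'a \<Rightarrow> real^'n^'k" where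
  "chart_jacobian U \<phi> f x = jacobian (f \<circ> inv_into U \<phi>) (at (\<phi> x))"

definition chart_gradient ::
  "'a set \<Rightarrow> ('a \<Rightarrow> real^'n) \<Rightarrow> ('a \<Rightarrow> real) \<Rightarrow> 'a \<Rightarrow> real^'n" where
  "chart_gradient U \<phi> h x = (\<chi> j. chart_differential U \<phi> h x (axis j 1))"

text \<open>The rank of the differential does not depend on the chart. The target may be a sphere,
  since the inclusion of its tangent space into the ambient space preserves the rank.\<close>

definition nonsingular_at ::
  "('a set \<times> ('a \<Rightarrow> real^'n)) set \<Rightarrow> ('a \<Rightarrow> 'b::euclidean_space) \<Rightarrow> 'a \<Rightarrow> bool" where
  "nonsingular_at A f x \<longleftrightarrow>
     (\<forall>(U, \<phi>) \<in> A. x \<in> U \<longrightarrow> dim (range (chart_differential U \<phi> f x)) = CARD('n))"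

definition frontal ::
  "'a topology \<Rightarrow> ('a set \<times> ('a \<Rightarrow> real^'n)) set \<Rightarrow> ('a \<Rightarrow> real^'m) \<Rightarrow> ('a \<Rightarrow> real^'m) \<Rightarrow> bool"
  where
  "frontal N A g \<nu> \<longleftrightarrow>
     smooth_map A g \<and> smooth_map A \<nu> \<and>
     \<nu> ` topspace N \<subseteq> sphere 0 1 \<and>
     (\<forall>(U, \<phi>) \<in> A. \<forall>x\<in>U. \<forall>v. chart_differential U \<phi> g x v \<bullet> \<nu> x = 0)"

definition no_silhouette ::
  "'a topology \<Rightarrow> ('a \<Rightarrow> real^'m) \<Rightarrow> ('a \<Rightarrow> real^'m) \<Rightarrow> (real^'m) set" where
  "no_silhouette N g \<nu> = {P. \<forall>x\<in>topspace N. (g x - P) \<bullet> \<nu> x \<noteq> 0}"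

definition negative_pedal ::
  "('a \<Rightarrow> real^'m) \<Rightarrow> ('a \<Rightarrow> real^'m) \<Rightarrow> real^'m \<Rightarrow> 'a \<Rightarrow> real^'m" where
  "negative_pedal g \<nu> P x =
     2 *\<^sub>R g x - P - ((norm (g x - P))\<^sup>2 / ((g x - P) \<bullet> \<nu> x)) *\<^sub>R \<nu> x"

definition negative_pedal_gauss :: "('a \<Rightarrow> real^'m) \<Rightarrow> real^'m \<Rightarrow> 'a \<Rightarrow> real^'m" where
  "negative_pedal_gauss g P x = (1 / norm (g x - P)) *\<^sub>R (g x - P)"

definition pedal_distance :: "('a \<Rightarrow> real^'m) \<Rightarrow> real^'m \<Rightarrow> 'a \<Rightarrow> real" where
  "pedal_distance g P x = norm (g x - P)"

definition sphere_tangent :: "real^'m \<Rightarrow> (real^'m) set" where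
  "sphere_tangent p = {v. v \<bullet> p = 0}"

definition orthonormal_tangent_basis :: "real^'m \<Rightarrow> ('n::finite \<Rightarrow> real^'m) \<Rightarrow> bool" where
  "orthonormal_tangent_basis p e \<longleftrightarrow>
     (\<forall>i j. e i \<bullet> e j = (if i = j then 1 else 0)) \<and>
     span (range e) = sphere_tangent p"

definition frame_vector :: "('n::finite \<Rightarrow> real^'m) \<Rightarrow> real^'n \<Rightarrow> real^'m" where
  "frame_vector e y = (\<Sum>i\<in>UNIV. (y $ i) *\<^sub>R e i)"

text \<open>The Riemannian exponential map of the unit sphere at \<open>p\<close>: the geodesics are the great
  circles, see \<open>sphere_exp_geodesic\<close>. Note that \<open>sgn v = v /\<^sub>R norm v\<close> and \<open>sgn 0 = 0\<close>.\<close>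

definition sphere_exp :: "real^'m \<Rightarrow> real^'m \<Rightarrow> real^'m" where
  "sphere_exp p v = cos (norm v) *\<^sub>R p + sin (norm v) *\<^sub>R sgn v"

text \<open>The injectivity radius of the unit sphere is \<open>pi\<close>, so these coordinates are defined on the
  sphere without the antipode of \<open>p\<close>.\<close>

definition normal_coords :: "real^'m \<Rightarrow> ('n::finite \<Rightarrow> real^'m) \<Rightarrow> real^'m \<Rightarrow> real^'n" where
  "normal_coords p e = inv_into (ball 0 pi) (\<lambda>y. sphere_exp p (frame_vector e y))"

text \<open>A curve in the sphere is a geodesic (for the metric induced from the Euclidean one) if its
  acceleration is normal to the sphere.\<close>

lemma sphere_exp_geodesic:
  fixes p v :: "real^'m"
  assumes p: "p \<in> sphere 0 1" and v: "v \<in> sphere_tangent p"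
  defines "c \<equiv> \<lambda>t. sphere_exp p (t *\<^sub>R v)"
  shows "c 0 = p" and "c t \<in> sphere 0 1"
    and "\<exists>c'. (\<forall>t. (c has_vector_derivative c' t) (at t)) \<and> c' 0 = v \<and>
           (\<forall>t. (c' has_vector_derivative (- ((norm v)\<^sup>2)) *\<^sub>R c t) (at t))"
proof -
  define r u where "r = norm v" and "u = sgn v"
  have c: "c t = cos (t * r) *\<^sub>R p + sin (t * r) *\<^sub>R u" for t
  proof (cases t "0 :: real" rule: linorder_cases)
    case less
    then show ?thesis
      by (simp add: c_def sphere_exp_def r_def u_def sgn_scaleR)
  next
    case equal
    then show ?thesis by (simp add: c_def sphere_exp_def)
  next
    case greater
    then show ?thesis
      by (simp add: c_def sphere_exp_def r_def u_def sgn_scaleR)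
  qed
  have ru: "r *\<^sub>R u = v"
    by (cases "v = 0") (simp_all add: r_def u_def sgn_div_norm)
  have pp: "p \<bullet> p = 1"
    using p by (simp add: dot_square_norm)
  have up: "u \<bullet> p = 0"
    using v by (simp add: u_def sgn_div_norm sphere_tangent_def)
  have uu: "v \<noteq> 0 \<Longrightarrow> u \<bullet> u = 1"
    by (simp add: u_def dot_square_norm norm_sgn)
  show "c 0 = p"
    by (simp add: c)
  have "c t \<bullet> c t = 1"
  proof (cases "v = 0")
    case True
    then show ?thesis by (simp add: c r_def u_def pp)
  next
    case False
    have "c t \<bullet> c t = (cos (t * r))\<^sup>2 + (sin (t * r))\<^sup>2"
      using False by (simp add: c inner_add_left inner_add_right pp up uu inner_commute[of p u]
          power2_eq_square)
    then show ?thesis by simp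
  qed
  then show "c t \<in> sphere 0 1"
    by (simp add: norm_eq_sqrt_inner)
  define c' where "c' t = cos (t * r) *\<^sub>R v - (r * sin (t * r)) *\<^sub>R p" for t
  have "(c has_vector_derivative c' t) (at t)" for t
  proof -
    have "((\<lambda>t. cos (t * r) *\<^sub>R p + sin (t * r) *\<^sub>R u) has_vector_derivative
        (- (sin (t * r) * r)) *\<^sub>R p + (cos (t * r) * r) *\<^sub>R u) (at t)"
      by (auto intro!: derivative_eq_intros)
    moreover have "(- (sin (t * r) * r)) *\<^sub>R p + (cos (t * r) * r) *\<^sub>R u = c' t"
      by (simp add: c'_def ru[symmetric] mult.commute)
    moreover have "c = (\<lambda>t. cos (t * r) *\<^sub>R p + sin (t * r) *\<^sub>R u)"
      using c by blast
    ultimately show ?thesis by simp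
  qed
  moreover have "(c' has_vector_derivative (- ((norm v)\<^sup>2)) *\<^sub>R c t) (at t)" for t
  proof -
    have "((\<lambda>t. cos (t * r) *\<^sub>R v - (r * sin (t * r)) *\<^sub>R p) has_vector_derivative
        (- (sin (t * r) * r)) *\<^sub>R v - (r * (cos (t * r) * r)) *\<^sub>R p) (at t)"
      by (auto intro!: derivative_eq_intros)
    moreover have "(- (sin (t * r) * r)) *\<^sub>R v - (r * (cos (t * r) * r)) *\<^sub>R p
        = (- ((norm v)\<^sup>2)) *\<^sub>R c t"
    proof -
      have "(sin (t * r) * r) *\<^sub>R v = (sin (t * r) * r * r) *\<^sub>R u"
        by (simp flip: ru)
      then show ?thesis
        by (simp add: c algebra_simps power2_eq_square flip: r_def)
    qed
    moreover have "c' = (\<lambda>t. cos (t * r) *\<^sub>R v - (r * sin (t * r)) *\<^sub>R p)"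
      using c'_def by blast
    ultimately show ?thesis by simp
  qed
  moreover have "c' 0 = v"
    by (simp add: c'_def)
  ultimately show "\<exists>c'. (\<forall>t. (c has_vector_derivative c' t) (at t)) \<and> c' 0 = v \<and>
           (\<forall>t. (c' has_vector_derivative (- ((norm v)\<^sup>2)) *\<^sub>R c t) (at t))"
    by blast
qed

lemma normal_coords_sphere_exp:
  fixes p :: "real^'m" and e :: "'n::finite \<Rightarrow> real^'m"
  assumes p: "p \<in> sphere 0 1" and e: "orthonormal_tangent_basis p e" and y: "norm y < pi"
  shows "normal_coords p e (sphere_exp p (frame_vector e y)) = y"
proof -
  have pp: "p \<bullet> p = 1"
    using p by (simp add: dot_square_norm)
  have ee: "e i \<bullet> e j = (if i = j then 1 else 0)" for i j
    using e by (simp add: orthonormal_tangent_basis_def)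
  have ep: "e i \<bullet> p = 0" for i
    using e span_base[of "e i" "range e"]
    by (simp add: orthonormal_tangent_basis_def sphere_tangent_def)
  have fe: "frame_vector e z \<bullet> e i = z $ i" for z i
    by (simp add: frame_vector_def inner_sum_left ee if_distrib cong: if_cong)
  have fp: "frame_vector e z \<bullet> p = 0" for z
    by (simp add: frame_vector_def inner_sum_left ep)
  have "frame_vector e z \<bullet> frame_vector e z = z \<bullet> z" for z
  proof -
    have "frame_vector e z \<bullet> frame_vector e z = (\<Sum>i\<in>UNIV. z $ i * (frame_vector e z \<bullet> e i))"
      by (subst (2) frame_vector_def) (simp only: inner_sum_right inner_scaleR_right)
    then show ?thesis
      by (simp only: fe) (simp add: inner_vec_def)
  qed
  then have nf: "norm (frame_vector e z) = norm z" for z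
    by (simp add: norm_eq_sqrt_inner)
  have E_p: "sphere_exp p (frame_vector e z) \<bullet> p = cos (norm z)" for z
    by (simp add: sphere_exp_def nf inner_add_left pp sgn_div_norm fp)
  have E_e: "sphere_exp p (frame_vector e z) \<bullet> e i = sin (norm z) / norm z * z $ i" for z i
    by (simp add: sphere_exp_def nf inner_add_left ep inner_commute[of p] sgn_div_norm fe
        divide_inverse)
  have "inj_on (\<lambda>y. sphere_exp p (frame_vector e y)) (ball 0 pi)"
  proof (rule inj_onI)
    fix a b
    assume a: "a \<in> ball 0 pi" and b: "b \<in> ball 0 pi"
      and eq: "sphere_exp p (frame_vector e a) = sphere_exp p (frame_vector e b)"
    have "cos (norm a) = cos (norm b)"
      using eq E_p[of a] E_p[of b] by simp
    then have n: "norm a = norm b"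
      using a b cos_inj_pi[of "norm a" "norm b"] by simp
    show "a = b"
    proof (cases "a = 0")
      case True
      then show ?thesis using n by simp
    next
      case False
      then have "sin (norm a) / norm a \<noteq> 0"
        using a sin_gt_zero[of "norm a"] by simp
      moreover have "sin (norm a) / norm a * a $ i = sin (norm a) / norm a * b $ i" for i
        using eq n E_e[of a i] E_e[of b i] by auto
      ultimately show ?thesis by (metis mult_left_cancel vec_eq_iff)
    qed
  qed
  then show ?thesis
    unfolding normal_coords_def using y
    by (subst inv_into_f_f) auto
qed

end

theory Submission
  imports Defs
begin

text \<open>Write \<open>p = \<nu>~(x)\<close> and \<open>w = f~(x) - g(x)\<close>. Then \<open>w\<close> is orthogonal to \<open>p\<close>, and since \<open>dg\<close> is
  orthogonal to \<open>\<nu>\<close>, \<open>w \<bullet> dg = (g - P) \<bullet> dg = \<gamma> d\<gamma>\<close>. Differentiating \<open>g = P + \<gamma> \<nu>~\<close> gives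
  \<open>w \<bullet> dg = \<gamma> (w \<bullet> d\<nu>~)\<close>, hence \<open>w \<bullet> d\<nu>~ = d\<gamma>\<close>. Normal coordinates have the identity as their
  differential at the centre, so in an orthonormal frame of the tangent space at \<open>p\<close> this reads
  \<open>J\<^sup>t c = \<nabla>\<gamma>\<close>, where \<open>c\<close> are the coordinates of \<open>w\<close>.\<close>

section \<open>Coordinates in an orthonormal tangent frame\<close>

text \<open>Defined on the whole ambient space, not just on the tangent space, so that it is linear
  and can be composed with ambient derivatives.\<close>

definition frame_coords :: "('n::finite \<Rightarrow> real^'m) \<Rightarrow> real^'m \<Rightarrow> real^'n" where
  "frame_coords e k = (\<chi> i. k \<bullet> e i)"

lemma bounded_linear_frame_coords: "bounded_linear (frame_coords e)"
  unfolding linear_conv_bounded_linear[symmetric]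
  by (rule linearI) (simp_all add: frame_coords_def vec_eq_iff inner_add_left)

lemma linear_frame_vector: "linear (frame_vector e)"
  by (rule linearI)
    (simp_all add: frame_vector_def scaleR_add_left sum.distrib scaleR_sum_right)

lemma frame_coords_frame_vector:
  assumes "orthonormal_tangent_basis p e"
  shows "frame_coords e (frame_vector e y) = y"
proof -
  have ee: "e i \<bullet> e j = (if i = j then 1 else 0)" for i j
    using assms by (simp add: orthonormal_tangent_basis_def)
  show ?thesis
    by (simp add: ee frame_coords_def frame_vector_def inner_sum_left vec_eq_iff if_distrib
        cong: if_cong)
qed

text \<open>Adjointness. It makes \<open>frame_vector e\<close> an isometry for orthonormal
  \<open>e\<close> and later turns ambient inner products into matrix entries.\<close>

lemma frame_vector_inner: "frame_vector e y \<bullet> k = y \<bullet> frame_coords e k"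
  by (simp add: frame_vector_def frame_coords_def inner_sum_left inner_vec_def[of y]
      inner_commute[of k])

lemma norm_frame_vector:
  assumes "orthonormal_tangent_basis p e"
  shows "norm (frame_vector e y) = norm y"
  by (simp add: norm_eq_sqrt_inner frame_vector_inner frame_coords_frame_vector[OF assms])

text \<open>The residual \<open>d\<close> lies in the span of the frame and is orthogonal to every
  frame vector, hence to itself.\<close>

lemma frame_vector_frame_coords:
  assumes e: "orthonormal_tangent_basis p e" and k: "k \<bullet> p = 0"
  shows "frame_vector e (frame_coords e k) = k"
proof -
  define d where "d = k - frame_vector e (frame_coords e k)"
  have d_e: "d \<bullet> e i = 0" for i
    using arg_cong[OF frame_coords_frame_vector[OF e, of "frame_coords e k"], of "\<lambda>y. y $ i"]
    by (simp add: d_def inner_diff_left frame_coords_def)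
  have "frame_vector e y \<in> span (range e)" for y
    unfolding frame_vector_def by (intro span_sum span_scale span_base) simp
  moreover have "k \<in> span (range e)"
    using e k by (simp add: orthonormal_tangent_basis_def sphere_tangent_def)
  ultimately have "d \<in> span (range e)"
    unfolding d_def by (intro span_diff)
  moreover have "orthogonal d z" if "z \<in> range e" for z
    using that d_e by (auto simp: orthogonal_def)
  ultimately have "orthogonal d d"
    by (rule orthogonal_to_span)
  then have "d = 0"
    by (simp add: orthogonal_def)
  then show ?thesis
    by (simp add: d_def)
qed

lemma sgn_frame_vector:
  assumes "orthonormal_tangent_basis p e"
  shows "sgn (frame_vector e y) = frame_vector e (sgn y)"
  by (simp add: sgn_div_norm norm_frame_vector[OF assms] linear_cmul[OF linear_frame_vector])

section \<open>Normal coordinates of the sphere near their centre\<close>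

text \<open>On the hemisphere around \<open>p\<close> the tangential part of \<open>k\<close> has length \<open>sin \<theta>\<close>, where \<open>\<theta> < pi/2\<close> is
  the geodesic distance from \<open>p\<close>. This form is easier to differentiate at \<open>p\<close> than the one with
  \<open>arccos (k \<bullet> p)\<close>, since \<open>arccos\<close> is not differentiable at 1.\<close>

lemma normal_coords_eq:
  assumes p: "p \<in> sphere 0 1" and e: "orthonormal_tangent_basis p e"
    and k: "norm k = 1" "k \<bullet> p > 0"
  shows "normal_coords p e k =
    arcsin (norm (frame_coords e k)) *\<^sub>R sgn (frame_coords e k)"
proof -
  define u where "u = frame_coords e k"
  define y where "y = arcsin (norm u) *\<^sub>R sgn u"
  have pp: "p \<bullet> p = 1"
    using p by (simp add: dot_square_norm)
  have "e i \<bullet> p = 0" for i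
    using e span_base[of "e i" "range e"]
    by (simp add: orthonormal_tangent_basis_def sphere_tangent_def)
  then have p_e: "frame_coords e p = 0"
    by (simp add: frame_coords_def vec_eq_iff inner_commute)
  \<comment> \<open>Removing the component along \<open>p\<close> leaves the coordinates unchanged,
    so \<open>u\<close> represents the tangential part of \<open>k\<close>.\<close>
  have "frame_coords e (k - (k \<bullet> p) *\<^sub>R p) = u"
    using p_e by (simp add: u_def frame_coords_def vec_eq_iff inner_diff_left)
  moreover have "(k - (k \<bullet> p) *\<^sub>R p) \<bullet> p = 0"
    by (simp add: inner_diff_left pp)
  ultimately have fu: "frame_vector e u = k - (k \<bullet> p) *\<^sub>R p"
    using frame_vector_frame_coords[OF e] by metis
  have "(norm u)\<^sup>2 = frame_vector e u \<bullet> k"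
    by (simp add: frame_vector_inner dot_square_norm flip: u_def)
  also have "\<dots> = 1 - (k \<bullet> p)\<^sup>2"
    using k by (simp add: fu inner_diff_left dot_square_norm power2_eq_square inner_commute[of p])
  finally have nu2: "(norm u)\<^sup>2 = 1 - (k \<bullet> p)\<^sup>2" .
  then have nu: "norm u < 1"
    using k by (intro power2_less_imp_less[of _ 1]) auto
  have ny: "norm y = arcsin (norm u)"
    using nu arcsin_le_arcsin[of 0 "norm u"] by (cases "u = 0") (auto simp: y_def norm_sgn)
  have lt: "arcsin (norm u) < pi / 2"
    using nu arcsin_lt_bounded[of "norm u"] norm_ge_zero[of u] by linarith
  then have "norm y < pi"
    using pi_gt_zero ny by linarith
  \<comment> \<open>It remains to see that the exponential map sends \<open>y\<close> to
    \<open>k\<close>.\<close>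
  then have "normal_coords p e (sphere_exp p (frame_vector e y)) = y"
    by (rule normal_coords_sphere_exp[OF p e])
  moreover have "sphere_exp p (frame_vector e y) = k"
  proof -
    have nu': "-1 \<le> norm u"
      by (rule order_trans[OF _ norm_ge_zero]) simp
    \<comment> \<open>The cosine of an arcsine is the nonnegative root of
      \<open>1 - (norm u)\<^sup>2\<close>; the hemisphere condition makes this
      \<open>k \<bullet> p\<close> rather than its negative.\<close>
    then have "cos (norm y) = k \<bullet> p"
      using nu nu2 k by (simp add: ny cos_arcsin)
    moreover have "sin (norm y) *\<^sub>R sgn y = u"
    proof (cases "u = 0")
      case False
      then have "arcsin (norm u) > 0"
        using nu arcsin_less_arcsin[of 0 "norm u"] by simp
      then have "sgn y = sgn u"
        using False by (simp add: y_def sgn_scaleR) (simp add: sgn_div_norm)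
      then show ?thesis
        using nu nu' False by (simp add: ny) (simp add: sgn_div_norm)
    qed (simp add: y_def)
    ultimately show ?thesis
      by (simp add: sphere_exp_def norm_frame_vector[OF e] sgn_frame_vector[OF e] fu
          flip: linear_cmul[OF linear_frame_vector])
  qed
  ultimately show ?thesis
    by (simp add: y_def u_def)
qed

text \<open>Away from 0 the map multiplies \<open>u\<close> by
  \<open>arcsin (norm u) / norm u\<close>. This factor tends to 1, because \<open>arcsin\<close> has
  derivative 1 at 0, and its distance from 1 is the relative error of the linearization.\<close>

lemma has_derivative_arcsin_norm_sgn:
  "((\<lambda>u::'a::real_normed_vector. arcsin (norm u) *\<^sub>R sgn u) has_derivative (\<lambda>u. u)) (at 0)"
proof -
  have "(arcsin has_real_derivative 1) (at 0)"
    using DERIV_arcsin[of 0] by simp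
  then have "((\<lambda>t. arcsin t / t) \<longlongrightarrow> 1) (at 0)"
    by (simp add: DERIV_def)
  moreover have "filterlim norm (at 0) (at (0::'a))"
    unfolding filterlim_at by (auto intro!: tendsto_eq_intros simp: eventually_at_filter)
  ultimately have "((\<lambda>u::'a. arcsin (norm u) / norm u) \<longlongrightarrow> 1) (at 0)"
    by (rule filterlim_compose)
  then have "((\<lambda>u::'a. \<bar>arcsin (norm u) / norm u - 1\<bar>) \<longlongrightarrow> 0) (at 0)"
    using tendsto_rabs[OF tendsto_diff[OF _ tendsto_const[of 1]]] by fastforce
  moreover have "\<forall>\<^sub>F u::'a in at 0. \<bar>arcsin (norm u) / norm u - 1\<bar> =
      norm (arcsin (norm u) *\<^sub>R sgn u - u) / norm u"
  proof (rule eventually_at_filter[THEN iffD2], intro always_eventually allI impI)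
    fix u :: 'a assume "u \<noteq> 0"
    then have "arcsin (norm u) *\<^sub>R sgn u - u = (arcsin (norm u) / norm u - 1) *\<^sub>R u"
      by (simp add: sgn_div_norm scaleR_diff_left divide_inverse)
    then show "\<bar>arcsin (norm u) / norm u - 1\<bar> = norm (arcsin (norm u) *\<^sub>R sgn u - u) / norm u"
      using \<open>u \<noteq> 0\<close> by simp
  qed
  ultimately have "((\<lambda>u::'a. norm (arcsin (norm u) *\<^sub>R sgn u - u) / norm u) \<longlongrightarrow> 0) (at 0)"
    by (rule Lim_transform_eventually)
  then show ?thesis
    by (simp add: has_derivative_at bounded_linear_ident)
qed

text \<open>By continuity \<open>h\<close> stays in the open hemisphere around \<open>h a\<close>,
  where the arcsine formula is valid. The frame coordinates of \<open>h a\<close> vanish, so the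
  chain rule uses that formula only at 0, where its derivative is the identity.\<close>

lemma has_derivative_normal_coords_comp:
  fixes h :: "'b::euclidean_space \<Rightarrow> real^'m"
  assumes h: "(h has_derivative D) (at a)"
    and unit: "\<forall>\<^sub>F z in nhds a. norm (h z) = 1"
    and e: "orthonormal_tangent_basis (h a) e"
  shows "((normal_coords (h a) e \<circ> h) has_derivative (\<lambda>v. frame_coords e (D v))) (at a)"
proof -
  have pn: "norm (h a) = 1"
    using unit by (rule eventually_nhds_x_imp_x)
  then have p: "h a \<in> sphere 0 1"
    by simp
  have "e i \<bullet> h a = 0" for i
    using e span_base[of "e i" "range e"]
    by (simp add: orthonormal_tangent_basis_def sphere_tangent_def)
  then have zero: "frame_coords e (h a) = 0"
    by (simp add: frame_coords_def vec_eq_iff inner_commute)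
  have "((\<lambda>z. frame_coords e (h z)) has_derivative (\<lambda>v. frame_coords e (D v))) (at a)"
    by (rule bounded_linear.has_derivative[OF bounded_linear_frame_coords h])
  then have der: "((\<lambda>z. arcsin (norm (frame_coords e (h z))) *\<^sub>R sgn (frame_coords e (h z)))
      has_derivative (\<lambda>v. frame_coords e (D v))) (at a)"
    by (rule has_derivative_compose)
      (use has_derivative_arcsin_norm_sgn in \<open>simp add: zero\<close>)
  have "isCont (\<lambda>z. h z \<bullet> h a) a"
    using has_derivative_continuous[OF h] by (intro continuous_intros)
  then have "((\<lambda>z. h z \<bullet> h a) \<longlongrightarrow> h a \<bullet> h a) (nhds a)"
    by (simp add: isCont_def tendsto_nhds_iff)
  moreover have "h a \<bullet> h a > 0"
    using pn by (simp add: dot_square_norm)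
  ultimately have "\<forall>\<^sub>F z in nhds a. h z \<bullet> h a > 0"
    by (rule order_tendstoD)
  with unit have eq: "\<forall>\<^sub>F z in nhds a. arcsin (norm (frame_coords e (h z))) *\<^sub>R
      sgn (frame_coords e (h z)) = (normal_coords (h a) e \<circ> h) z"
    by eventually_elim (simp add: normal_coords_eq[OF p e])
  show ?thesis
    by (rule has_derivative_transform_eventually[OF der])
      (use eq eventually_nhds_x_imp_x[OF eq] in \<open>simp_all add: eventually_nhds_conv_at\<close>)
qed

section \<open>The negative pedal identity\<close>

theorem theorem3:
  fixes N :: "'a topology"
    and A :: "('a set \<times> ('a \<Rightarrow> real^'n)) set"
    and g \<nu> :: "'a \<Rightarrow> real^'m"
    and P :: "real^'m"
    and x :: 'a
    and U :: "'a set"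
    and \<phi> :: "'a \<Rightarrow> real^'n"
    and e :: "'n \<Rightarrow> real^'m"
  assumes "CARD('m) = CARD('n) + 1"
    and "smooth_manifold N A"
    and "frontal N A g \<nu>"
    and "P \<in> no_silhouette N g \<nu>"
    and "x \<in> topspace N"
    and "nonsingular_at A (negative_pedal_gauss g P) x"
    and "(U, \<phi>) \<in> A" and "x \<in> U"
    and "orthonormal_tangent_basis (negative_pedal_gauss g P x) e"
  shows "negative_pedal g \<nu> P x - g x =
    frame_vector e
      (transpose (matrix_inv
         (chart_jacobian U \<phi>
            (normal_coords (negative_pedal_gauss g P x) e \<circ> negative_pedal_gauss g P) x))
       *v chart_gradient U \<phi> (pedal_distance g P) x)
    + 0 *\<^sub>R negative_pedal_gauss g P x"
proof -
  define G where "G = g \<circ> inv_into U \<phi>"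
  define a where "a = \<phi> x"
  define D where "D = frechet_derivative G (at a)"
  define r where "r = norm (g x - P)"
  define p where "p = negative_pedal_gauss g P x"
  define h where "h = negative_pedal_gauss g P \<circ> inv_into U \<phi>"
  have chart: "chart_on N U \<phi>"
    using assms(2,7) unfolding smooth_manifold_def by blast
  have "openin N U"
    using chart by (simp add: chart_on_def)
  then have "inj_on \<phi> U"
    using chart openin_subset[of N U]
    by (auto simp: chart_on_def homeomorphic_map_def homeomorphic_eq_everything_map
        inf_absorb2)
  then have inv: "inv_into U \<phi> a = x"
    using assms(8) by (simp add: a_def)
  have Ga: "G a = g x" and ha: "h a = p"
    by (simp_all add: G_def h_def p_def inv)
  have "smooth_on (\<phi> ` U) G"
    using assms(3,7) unfolding frontal_def smooth_map_def G_def by blast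
  then have "k_smooth_on (Suc 0) (\<phi> ` U) G"
    unfolding smooth_on_def by blast
  then have G_deriv: "(G has_derivative D) (at a)"
    using assms(8) by (auto simp: D_def a_def frechet_derivative_works)
  have normal: "D v \<bullet> \<nu> x = 0" for v
    using assms(3,7,8) unfolding frontal_def chart_differential_def D_def G_def a_def by blast
  have silh: "(g x - P) \<bullet> \<nu> x \<noteq> 0"
    using assms(4,5) by (simp add: no_silhouette_def)
  \<comment> \<open>If \<open>g x\<close> were \<open>P\<close>, the inner product with
    \<open>\<nu> x\<close> would vanish.\<close>
  then have r: "r > 0"
    by (auto simp: r_def)
  have p_eq: "g x - P = r *\<^sub>R p"
    using r by (simp add: p_def negative_pedal_gauss_def r_def)
  have pp: "p \<bullet> p = 1"
    using r by (simp add: p_def negative_pedal_gauss_def dot_square_norm r_def power2_eq_square)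
  \<comment> \<open>Differentiating the normalized vector leaves the part of \<open>D v\<close>
    orthogonal to \<open>p\<close>, divided by the distance \<open>r\<close>.\<close>
  define Dh where "Dh v = (1 / r) *\<^sub>R (D v - (D v \<bullet> p) *\<^sub>R p)" for v
  have dist_deriv: "((pedal_distance g P \<circ> inv_into U \<phi>) has_derivative (\<lambda>v. D v \<bullet> p)) (at a)"
  proof -
    have eq: "pedal_distance g P \<circ> inv_into U \<phi> = (\<lambda>z. norm (G z - P))"
      by (auto simp: pedal_distance_def G_def)
    have "((\<lambda>z. G z - P) has_derivative D) (at a)"
      using has_derivative_diff[OF G_deriv has_derivative_const] by simp
    moreover have "(norm has_derivative (\<lambda>v. v \<bullet> sgn (g x - P))) (at (G a - P))"
      using r has_derivative_norm[of "g x - P"] by (auto simp: Ga r_def)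
    ultimately have "((\<lambda>z. norm (G z - P)) has_derivative (\<lambda>v. D v \<bullet> sgn (g x - P))) (at a)"
      by (rule has_derivative_compose)
    moreover have "sgn (g x - P) = p"
      by (simp add: p_def negative_pedal_gauss_def sgn_div_norm divide_inverse)
    ultimately show ?thesis
      by (simp add: eq)
  qed
  have h_deriv: "(h has_derivative Dh) (at a)"
  proof -
    have eq: "h = (\<lambda>z. inverse (norm (G z - P)) *\<^sub>R (G z - P))"
      by (auto simp: negative_pedal_gauss_def G_def h_def divide_inverse)
    have norm_deriv: "((\<lambda>z. norm (G z - P)) has_derivative (\<lambda>v. D v \<bullet> p)) (at a)"
      using dist_deriv by (simp add: pedal_distance_def G_def o_def)
    have "((\<lambda>z. G z - P) has_derivative D) (at a)"
      using has_derivative_diff[OF G_deriv has_derivative_const] by simp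
    note has_derivative_scaleR[OF Deriv.has_derivative_inverse[OF _ norm_deriv] this]
    then have "(h has_derivative (\<lambda>v. (1 / r) *\<^sub>R D v -
        ((1 / r) * (D v \<bullet> p) * (1 / r)) *\<^sub>R (r *\<^sub>R p))) (at a)"
      using r by (simp add: eq Ga divide_inverse flip: r_def p_eq)
    moreover have "(1 / r) *\<^sub>R D v - ((1 / r) * (D v \<bullet> p) * (1 / r)) *\<^sub>R (r *\<^sub>R p) = Dh v" for v
      using r by (simp add: Dh_def scaleR_diff_right)
    ultimately show ?thesis
      by simp
  qed
  have Dh_p: "Dh v \<bullet> p = 0" for v
    by (simp add: Dh_def inner_diff_left pp)
  \<comment> \<open>The unit length of \<open>h\<close> is claimed only near \<open>a\<close>:
    outside the image of the chart, \<open>inv_into\<close> is unspecified and \<open>G z\<close>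
    might be \<open>P\<close>.\<close>
  have "isCont (\<lambda>z. norm (G z - P)) a"
    using has_derivative_continuous[OF G_deriv] by (intro continuous_intros)
  then have "((\<lambda>z. norm (G z - P)) \<longlongrightarrow> r) (nhds a)"
    by (simp add: isCont_def tendsto_nhds_iff Ga r_def)
  then have "\<forall>\<^sub>F z in nhds a. norm (G z - P) > 0"
    using r by (rule order_tendstoD)
  then have unit: "\<forall>\<^sub>F z in nhds a. norm (h z) = 1"
    by eventually_elim (simp add: h_def negative_pedal_gauss_def G_def)
  have basis: "orthonormal_tangent_basis p e"
    using assms(9) by (simp add: p_def)
  define J where "J = chart_jacobian U \<phi> (normal_coords p e \<circ> negative_pedal_gauss g P) x"
  have nc: "((normal_coords p e \<circ> h) has_derivative (\<lambda>v. frame_coords e (Dh v))) (at a)"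
    using has_derivative_normal_coords_comp[OF h_deriv unit] basis by (simp add: ha)
  then have J: "J = matrix (\<lambda>v. frame_coords e (Dh v))"
    by (simp add: J_def chart_jacobian_def jacobian_def h_def a_def comp_assoc
        flip: frechet_derivative_at)
  have lin: "linear (\<lambda>v. frame_coords e (Dh v))"
    using nc by (rule has_derivative_linear)
  have "chart_differential U \<phi> (negative_pedal_gauss g P) x = Dh"
    using frechet_derivative_at[OF h_deriv] by (simp add: chart_differential_def h_def a_def)
  then have "dim (range Dh) = CARD('n)"
    using assms(6,7,8) unfolding nonsingular_at_def by auto
  moreover have "(*v) (matrix Dh) = Dh"
    by (rule matrix_vector_mul(2)[OF has_derivative_linear[OF h_deriv]])
  ultimately have "inj Dh"
    using full_rank_injective[of "matrix Dh"] by (simp add: rank_dim_range)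
  \<comment> \<open>The values of \<open>Dh\<close> are tangent, so passing to frame coordinates
    keeps injectivity; \<open>J\<close> is square, hence invertible.\<close>
  then have "inj (\<lambda>v. frame_vector e (frame_coords e (Dh v)))"
    by (simp add: frame_vector_frame_coords[OF basis Dh_p])
  then have "inj (\<lambda>v. frame_coords e (Dh v))"
    by (simp add: inj_def)
  then have "inj ((*v) J)"
    by (simp add: J matrix_vector_mul(2)[OF lin])
  then have "invertible J"
    by (simp add: invertible_left_inverse matrix_left_invertible_injective)
  then have J_inv: "J ** matrix_inv J = mat 1"
    unfolding invertible_def matrix_inv_def by (metis (mono_tags, lifting) someI_ex)
  define w where "w = negative_pedal g \<nu> P x - g x"
  have w: "w = r *\<^sub>R p - (r\<^sup>2 / ((g x - P) \<bullet> \<nu> x)) *\<^sub>R \<nu> x"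
    unfolding p_eq[symmetric] by (simp add: w_def negative_pedal_def r_def scaleR_2)
  \<comment> \<open>Since \<open>(g x - P) \<bullet> \<nu> x\<close> equals
    \<open>r * (p \<bullet> \<nu> x)\<close>, both terms of \<open>w\<close> contribute
    \<open>r\<close> and cancel.\<close>
  have w_p: "w \<bullet> p = 0"
    using silh r
    by (simp add: w inner_diff_left pp p_eq inner_commute[of "\<nu> x" p] power2_eq_square)
  have w_D: "w \<bullet> D v = r * (D v \<bullet> p)" for v
    using normal[of v] by (simp add: w inner_diff_right inner_commute[of _ "D v"])
  have w_Dh: "w \<bullet> Dh v = D v \<bullet> p" for v
    using r by (simp add: Dh_def inner_diff_right w_p w_D)
  have gradient: "chart_gradient U \<phi> (pedal_distance g P) x = transpose J *v frame_coords e w"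
  proof -
    have "frechet_derivative (pedal_distance g P \<circ> inv_into U \<phi>) (at a) = (\<lambda>v. D v \<bullet> p)"
      using frechet_derivative_at[OF dist_deriv] by simp
    moreover have "D v \<bullet> p = (\<Sum>i\<in>UNIV. frame_coords e (Dh v) $ i * frame_coords e w $ i)" for v
      using frame_vector_inner[of e "frame_coords e (Dh v)" w] w_Dh[of v]
      by (simp add: frame_vector_frame_coords[OF basis Dh_p] inner_commute[of "Dh v" w]
          inner_vec_def[of "frame_coords e _"])
    ultimately show ?thesis
      by (simp add: chart_gradient_def chart_differential_def a_def J vec_eq_iff
          matrix_vector_mult_def transpose_def matrix_def)
  qed
  \<comment> \<open>Transposition reverses products, so a right inverse of \<open>J\<close> becomes
    a left inverse of \<open>transpose J\<close>.\<close>
  have "transpose (matrix_inv J) ** transpose J = mat 1"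
    by (simp add: J_inv flip: matrix_transpose_mul)
  then have "transpose (matrix_inv J) *v chart_gradient U \<phi> (pedal_distance g P) x = frame_coords e w"
    by (simp only: gradient matrix_vector_mul_assoc matrix_vector_mul_lid)
  then show ?thesis
    using frame_vector_frame_coords[OF basis w_p]
    by (simp add: J_def w_def flip: p_def)
qed

end
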